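(* Let $d\ge2$. The following hold: (1) The space $(\mathcal{S}_{1,b}^d,\tau_{W^r})$ is homeomorphic to $C_p^+(\mathbb{S}^{d-1})$. In particular, $\tau_{W^r}$ is not a metrizable topology on $\mathcal{S}_{1,b}^d$, on $\mathcal{S}_1^d$, or on $\mathcal{S}_{rc}^d$. (2) On $\mathcal{S}_{1,b}^d$ and on $\mathcal{S}_{rc,b}^d$, $\tau_{W^r}\subseteq\tau_\delta$ and the inclusion is strict.
   Context: $B_2^d$ and $\mathbb{S}^{d-1}$ are the closed Euclidean unit ball and the unit sphere of $\mathbb{R}^d$. A star set is a non-empty $A\subseteq\mathbb{R}^d$ with $ta\in A$ for all $a\in A$, $0\le t\le 1$. Its radial function is $\rho_A:\mathbb{S}^{d-1}\to[0,\infty]$, $\rho_A(\theta)=\sup\{\lambda\ge 0:\lambda\theta\in A\}$. A star body is a star set $A$ that is radially closed: $\rho_A(\theta)\theta\in A$ whenever $\rho_A(\theta)<\infty$; it need not be closed or bounded. $\mathcal{S}_{rc}^d$ is the family of all star bodies in $\mathbb{R}^d$, $\mathcal{S}_{rc,b}^d$ the subfamily of bounded ones, $\mathcal{S}_1^d$ the subfamily of star bodies with continuous radial function $\rho_A:\mathbb{S}^{d-1}\to[0,\infty]$, and $\mathcal{S}_{1,b}^d$ the bounded members of $\mathcal{S}_1^d$. The radial sum $A_1\tilde{+}A_2$ is the star body with radial function $\rho_{A_1}+\rho_{A_2}$. The radial distance is $d_r(x,A)=\inf\{\alpha>0: x\in A\tilde{+}\alpha B_2^d\}$, $x\in\mathbb{R}^d$,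 $A\in\mathcal{S}_{rc}^d$. The radial Wijsman topology $\tau_{W^r}$ on $\mathcal{S}_{rc}^d$ is the weakest topology making all maps $A\mapsto d_r(x,A)$, $x\in\mathbb{R}^d$, continuous; on subfamilies $\tau_{W^r}$ denotes the subspace topology. $\tau_\delta$ is the topology induced by the radial metric $\delta(A_1,A_2)=\sup_{\theta\in\mathbb{S}^{d-1}}|\rho_{A_1}(\theta)-\rho_{A_2}(\theta)|$ on bounded star bodies. $C_p^+(\mathbb{S}^{d-1})$ is the set of continuous functions $f:\mathbb{S}^{d-1}\to[0,\infty)$ with the topology of pointwise convergence. *)

theory Defs
  imports "HOL-Analysis.Analysis"
begin

definition star_set :: "'a::euclidean_space set \<Rightarrow> bool" where
  "star_set A \<longleftrightarrow> A \<noteq> {} \<and> (\<forall>a\<in>A. \<forall>t\<in>{0..1}. t *\<^sub>R a \<in> A)"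

text \<open>Only the values on the unit sphere are meaningful.\<close>

definition radial_fun :: "'a::euclidean_space set \<Rightarrow> 'a \<Rightarrow> ennreal" where
  "radial_fun A \<theta> = (SUP r\<in>{r. 0 \<le> r \<and> r *\<^sub>R \<theta> \<in> A}. ennreal r)"

definition star_body :: "'a::euclidean_space set \<Rightarrow> bool" where
  "star_body A \<longleftrightarrow> star_set A \<and>
     (\<forall>\<theta>\<in>sphere 0 1. radial_fun A \<theta> < \<infinity> \<longrightarrow> enn2real (radial_fun A \<theta>) *\<^sub>R \<theta> \<in> A)"

definition S_rc :: "'a::euclidean_space set set" where
  "S_rc = {A. star_body A}"

definition S_rc_b :: "'a::euclidean_space set set" where
  "S_rc_b = {A \<in> S_rc. bounded A}"

definition S_1 :: "'a::euclidean_space set set" where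
  "S_1 = {A \<in> S_rc. continuous_on (sphere 0 1) (radial_fun A)}"

definition S_1_b :: "'a::euclidean_space set set" where
  "S_1_b = {A \<in> S_1. bounded A}"

definition radial_sum :: "'a::euclidean_space set \<Rightarrow> 'a set \<Rightarrow> 'a set" where
  "radial_sum A B = (THE C. star_body C \<and>
     (\<forall>\<theta>\<in>sphere 0 1. radial_fun C \<theta> = radial_fun A \<theta> + radial_fun B \<theta>))"

definition radial_dist :: "'a::euclidean_space \<Rightarrow> 'a set \<Rightarrow> real" where
  "radial_dist x A = Inf {\<alpha>. \<alpha> > 0 \<and> x \<in> radial_sum A ((*\<^sub>R) \<alpha> ` cball 0 1)}"

text \<open>The preimages of open sets form a subbase; taking \<open>U = UNIV\<close> shows that the carrier is
  \<open>S_rc\<close>.\<close>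

definition radial_Wijsman_topology :: "'a::euclidean_space set topology" where
  "radial_Wijsman_topology =
     topology_generated_by {{A \<in> S_rc. radial_dist x A \<in> U} | x U. open U}"

text \<open>The radial metric lives on the bounded star bodies; outside, the supremum of a set of reals may
  be unspecified (even negative), whereas \<open>Metric_space\<close> demands a non-negative function on the whole
  type, so it is extended by 0.\<close>

definition radial_metric :: "'a::euclidean_space set \<Rightarrow> 'a set \<Rightarrow> real" where
  "radial_metric A B =
     (if A \<in> S_rc_b \<and> B \<in> S_rc_b
      then SUP \<theta>\<in>sphere 0 1. \<bar>enn2real (radial_fun A \<theta>) - enn2real (radial_fun B \<theta>)\<bar>
      else 0)"

definition radial_metric_topology :: "'a::euclidean_space set topology" where
  "radial_metric_topology = Metric_space.mtopology S_rc_b radial_metric"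

text \<open>Functions on the sphere are represented by functions that are \<open>undefined\<close> outside the sphere:
  the carrier of \<open>powertop_real (sphere 0 1)\<close> is \<open>sphere 0 1 \<rightarrow>\<^sub>E UNIV\<close>.\<close>

definition Cp_plus_sphere :: "('a::euclidean_space \<Rightarrow> real) topology" where
  "Cp_plus_sphere = subtopology (powertop_real (sphere 0 1))
     {f. continuous_on (sphere 0 1) f \<and> (\<forall>\<theta>\<in>sphere 0 1. 0 \<le> f \<theta>)}"


text \<open>Well-definedness: a star body is determined by its radial function on the sphere, every
  function on the sphere with values in \<open>[0,\<infinity>]\<close> is the radial function of a star body, and the radial
  metric is a metric on the bounded star bodies.\<close>

lemma le_radial_funI: "0 \<le> r \<Longrightarrow> r *\<^sub>R \<theta> \<in> A \<Longrightarrow> ennreal r \<le> radial_fun A \<theta>"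
  unfolding radial_fun_def by (rule SUP_upper) simp

lemma star_body_mem_iff:
  assumes A: "star_body A" and \<theta>: "\<theta> \<in> sphere 0 1" and r: "0 \<le> r"
  shows "r *\<^sub>R \<theta> \<in> A \<longleftrightarrow> ennreal r \<le> radial_fun A \<theta>"
proof
  assume le: "ennreal r \<le> radial_fun A \<theta>"
  have scale: "r *\<^sub>R \<theta> \<in> A" if "s *\<^sub>R \<theta> \<in> A" "r \<le> s" for s
  proof (cases "s = 0")
    case True
    then show ?thesis using that r by simp
  next
    case False
    then have "(r / s) *\<^sub>R (s *\<^sub>R \<theta>) \<in> A"
    proof -
      have "r / s \<in> {0..1}" using that r False by (simp add: field_simps)
      then show ?thesis using A that(1) unfolding star_body_def star_set_def by blast
    qed
    then show ?thesis using False by simp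
  qed
  show "r *\<^sub>R \<theta> \<in> A"
  proof (cases "radial_fun A \<theta> < \<infinity>")
    case True
    then have "r \<le> enn2real (radial_fun A \<theta>)"
      using le r by (metis enn2real_ennreal enn2real_mono infinity_ennreal_def)
    then show ?thesis using A \<theta> True scale unfolding star_body_def by blast
  next
    case False
    then have "ennreal r < radial_fun A \<theta>"
      by (metis ennreal_less_top infinity_ennreal_def less_top)
    then obtain s where "s *\<^sub>R \<theta> \<in> A" "0 \<le> s" "ennreal r < ennreal s"
      unfolding radial_fun_def less_SUP_iff by auto
    then show ?thesis using scale r by (auto simp: ennreal_less_iff)
  qed
qed (use r in \<open>rule le_radial_funI\<close>)

lemma polar_ex: "\<exists>r \<theta>. x = r *\<^sub>R \<theta> \<and> 0 \<le> r \<and> \<theta> \<in> sphere (0::'a::euclidean_space) 1"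
proof (cases "x = 0")
  case True
  obtain b :: 'a where "b \<in> Basis" using nonempty_Basis by blast
  then show ?thesis using True by (intro exI[of _ 0] exI[of _ b]) simp
next
  case False
  then show ?thesis by (intro exI[of _ "norm x"] exI[of _ "sgn x"]) (simp add: sgn_div_norm)
qed

lemma star_body_eqI:
  fixes A B :: "'a::euclidean_space set"
  assumes "star_body A" "star_body B" "\<And>\<theta>. \<theta> \<in> sphere 0 1 \<Longrightarrow> radial_fun A \<theta> = radial_fun B \<theta>"
  shows "A = B"
proof (rule set_eqI)
  fix x :: 'a
  obtain r \<theta> where x: "x = r *\<^sub>R \<theta>" "0 \<le> r" "\<theta> \<in> sphere 0 1"
    using polar_ex[of x] by blast
  show "x \<in> A \<longleftrightarrow> x \<in> B"
    using star_body_mem_iff[OF assms(1) x(3,2)] star_body_mem_iff[OF assms(2) x(3,2)] assms(3)[OF x(3)]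
    by (simp only: x(1))
qed

lemma star_body_of_fun:
  fixes g :: "'a::euclidean_space \<Rightarrow> ennreal"
  defines "C \<equiv> {r *\<^sub>R \<theta> | r \<theta>. \<theta> \<in> sphere 0 1 \<and> 0 \<le> r \<and> ennreal r \<le> g \<theta>}"
  shows "star_body C" "\<theta> \<in> sphere 0 1 \<Longrightarrow> radial_fun C \<theta> = g \<theta>"
proof -
  have mem: "r *\<^sub>R \<theta> \<in> C \<longleftrightarrow> ennreal r \<le> g \<theta>" if \<theta>: "\<theta> \<in> sphere 0 1" and r: "0 \<le> r" for r \<theta>
  proof
    assume "r *\<^sub>R \<theta> \<in> C"
    then obtain s \<phi> where s: "r *\<^sub>R \<theta> = s *\<^sub>R \<phi>" "\<phi> \<in> sphere 0 1" "0 \<le> s" "ennreal s \<le> g \<phi>"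
      unfolding C_def by blast
    have "norm (r *\<^sub>R \<theta>) = norm (s *\<^sub>R \<phi>)" using s(1) by simp
    then have "r = s" using \<theta> r s(2,3) by simp
    then show "ennreal r \<le> g \<theta>" using s by (cases "r = 0") auto
  qed (use that C_def in blast)
  have rad: "radial_fun C \<theta> = g \<theta>" if \<theta>: "\<theta> \<in> sphere 0 1" for \<theta>
  proof (rule antisym)
    show "radial_fun C \<theta> \<le> g \<theta>"
      unfolding radial_fun_def by (rule SUP_least) (use mem[OF \<theta>] in auto)
    show "g \<theta> \<le> radial_fun C \<theta>"
    proof (rule dense_le)
      fix y assume y: "y < g \<theta>"
      then have "y < top" by (metis order.strict_trans2 top_greatest)
      then have "ennreal (enn2real y) = y" by simp
      then show "y \<le> radial_fun C \<theta>"
        using le_radial_funI[of "enn2real y" \<theta> C] mem[OF \<theta>, of "enn2real y"] y by simp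
    qed
  qed
  show "\<theta> \<in> sphere 0 1 \<Longrightarrow> radial_fun C \<theta> = g \<theta>" by (rule rad)
  show "star_body C"
    unfolding star_body_def star_set_def
  proof (intro conjI ballI impI)
    obtain \<theta> :: 'a where "\<theta> \<in> sphere 0 1" using polar_ex by blast
    then have "0 *\<^sub>R \<theta> \<in> C" using mem[of \<theta> 0] by simp
    then show "C \<noteq> {}" by blast
  next
    fix a t assume "a \<in> C" and t: "t \<in> {0..1::real}"
    then obtain s \<phi> where s: "a = s *\<^sub>R \<phi>" "\<phi> \<in> sphere 0 1" "0 \<le> s" "ennreal s \<le> g \<phi>"
      unfolding C_def by blast
    have "ennreal (t * s) \<le> ennreal s"
      using t s(3) by (intro ennreal_leI) (simp add: mult_left_le_one_le)
    then have "(t * s) *\<^sub>R \<phi> \<in> C" using mem[of \<phi> "t * s"] s t order_trans[OF _ s(4)] by simp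
    then show "t *\<^sub>R a \<in> C" using s by simp
  next
    fix \<theta> :: 'a assume "\<theta> \<in> sphere 0 1" "radial_fun C \<theta> < \<infinity>"
    then show "enn2real (radial_fun C \<theta>) *\<^sub>R \<theta> \<in> C"
      using mem rad by (simp add: less_top)
  qed
qed

lemma radial_sum_eq:
  "radial_sum A B =
     {r *\<^sub>R \<theta> | r \<theta>. \<theta> \<in> sphere 0 1 \<and> 0 \<le> r \<and> ennreal r \<le> radial_fun A \<theta> + radial_fun B \<theta>}"
  unfolding radial_sum_def
proof (rule the_equality)
  show "C = {r *\<^sub>R \<theta> | r \<theta>. \<theta> \<in> sphere 0 1 \<and> 0 \<le> r \<and> ennreal r \<le> radial_fun A \<theta> + radial_fun B \<theta>}"
    if "star_body C \<and> (\<forall>\<theta>\<in>sphere 0 1. radial_fun C \<theta> = radial_fun A \<theta> + radial_fun B \<theta>)" for C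
    using that star_body_of_fun[where g = "\<lambda>\<theta>. radial_fun A \<theta> + radial_fun B \<theta>"]
    by (intro star_body_eqI) auto
qed (use star_body_of_fun[where g = "\<lambda>\<theta>. radial_fun A \<theta> + radial_fun B \<theta>"] in auto)

lemma topspace_radial_Wijsman_topology: "topspace radial_Wijsman_topology = S_rc"
  unfolding radial_Wijsman_topology_def by auto

lemma radial_fun_bounded:
  fixes A :: "'a::euclidean_space set"
  assumes "A \<in> S_rc_b"
  obtains K where "0 \<le> K" "\<And>\<theta>. \<theta> \<in> sphere 0 1 \<Longrightarrow> radial_fun A \<theta> \<le> ennreal K"
proof -
  obtain K where K: "K > 0" "\<And>x. x \<in> A \<Longrightarrow> norm x \<le> K"
    using assms unfolding S_rc_b_def bounded_pos by blast
  show ?thesis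
  proof (rule that)
    show "0 \<le> K" using K by simp
    show "radial_fun A \<theta> \<le> ennreal K" if "\<theta> \<in> sphere 0 1" for \<theta>
      unfolding radial_fun_def using K(2) that by (intro SUP_least ennreal_leI) force
  qed
qed

lemma Metric_space_radial_metric: "Metric_space (S_rc_b :: 'a::euclidean_space set set) radial_metric"
proof -
  let ?S = "sphere (0::'a) 1"
  let ?h = "\<lambda>A B (\<theta>::'a). \<bar>enn2real (radial_fun A \<theta>) - enn2real (radial_fun B \<theta>)\<bar>"
  obtain e :: 'a where e: "e \<in> ?S" using polar_ex by blast
  have enn: "\<exists>K. \<forall>\<theta>\<in>?S. enn2real (radial_fun A \<theta>) \<le> K" if A: "A \<in> S_rc_b" for A :: "'a set"
  proof -
    obtain K where "0 \<le> K" "\<And>\<theta>. \<theta> \<in> sphere 0 1 \<Longrightarrow> radial_fun A \<theta> \<le> ennreal K"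
      using radial_fun_bounded[OF A] by metis
    then show ?thesis by (metis enn2real_leI)
  qed
  have bdd: "bdd_above (?h A B ` ?S)" if AB: "A \<in> S_rc_b" "B \<in> S_rc_b" for A B
  proof -
    obtain K where K: "\<forall>\<theta>\<in>?S. enn2real (radial_fun A \<theta>) \<le> K"
      using enn[OF AB(1)] ..
    obtain L where L: "\<forall>\<theta>\<in>?S. enn2real (radial_fun B \<theta>) \<le> L"
      using enn[OF AB(2)] ..
    have "?h A B \<theta> \<le> K + L" if "\<theta> \<in> ?S" for \<theta>
      using K[rule_format, OF that] L[rule_format, OF that]
        enn2real_nonneg[of "radial_fun A \<theta>"] enn2real_nonneg[of "radial_fun B \<theta>"]
      by linarith
    then show ?thesis by (intro bdd_aboveI2)
  qed
  have le: "?h A B \<theta> \<le> radial_metric A B" if "A \<in> S_rc_b" "B \<in> S_rc_b" "\<theta> \<in> ?S" for A B \<theta>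
    using cSUP_upper[OF that(3) bdd[OF that(1,2)]] that by (simp add: radial_metric_def)
  have nn: "0 \<le> radial_metric A B" for A B :: "'a set"
  proof (cases "A \<in> S_rc_b \<and> B \<in> S_rc_b")
    case True
    then show ?thesis using le[of A B e] e by linarith
  qed (auto simp: radial_metric_def)
  show ?thesis
  proof
    show "0 \<le> radial_metric A B" for A B :: "'a set" by (rule nn)
    show "radial_metric A B = radial_metric B A" for A B :: "'a set"
      unfolding radial_metric_def by (simp add: abs_minus_commute)
    show "radial_metric A B = 0 \<longleftrightarrow> A = B" if AB: "A \<in> S_rc_b" "B \<in> S_rc_b" for A B :: "'a set"
    proof
      assume 0: "radial_metric A B = 0"
      have "radial_fun A \<theta> = radial_fun B \<theta>" if "\<theta> \<in> ?S" for \<theta>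
      proof -
        have "enn2real (radial_fun A \<theta>) = enn2real (radial_fun B \<theta>)"
          using le[OF AB that] 0 by simp
        moreover have "radial_fun A \<theta> < top" "radial_fun B \<theta> < top"
          using radial_fun_bounded[OF AB(1)] radial_fun_bounded[OF AB(2)] that
          by (metis ennreal_less_top le_less_trans)+
        ultimately show ?thesis by (metis ennreal_enn2real)
      qed
      then show "A = B" using AB by (intro star_body_eqI) (auto simp: S_rc_b_def S_rc_def)
    next
      assume "A = B" then show "radial_metric A B = 0"
        unfolding radial_metric_def using e by (auto simp: image_constant_conv)
    qed
    show "radial_metric A C \<le> radial_metric A B + radial_metric B C"
      if "A \<in> S_rc_b" "B \<in> S_rc_b" "C \<in> S_rc_b" for A B C :: "'a set"
    proof -
      have "(SUP \<theta>\<in>?S. ?h A C \<theta>) \<le> radial_metric A B + radial_metric B C"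
      proof (rule cSUP_least)
        show "?S \<noteq> {}" using e by blast
        fix \<theta> assume \<theta>: "\<theta> \<in> ?S"
        show "?h A C \<theta> \<le> radial_metric A B + radial_metric B C"
          using le[OF that(1,2) \<theta>] le[OF that(2,3) \<theta>] by linarith
      qed
      then show ?thesis using that by (simp add: radial_metric_def)
    qed
  qed
qed

end

theory Submission
  imports Defs
begin

text \<open>In polar coordinates \<open>d\<^sub>r(r\<theta>, A) = max 0 (r - \<rho>\<^sub>A(\<theta>))\<close>, so the radial Wijsman topology is
  the topology of pointwise convergence of radial functions; this gives the homeomorphism.
  In particular a neighbourhood of \<open>A\<close> only constrains \<open>\<rho>\<^sub>A\<close> in finitely many directions,
  whereas the sphere is uncountable for \<open>d \<ge> 2\<close>. Bodies that vanish in finitely many prescribed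
  directions and have \<open>\<rho> = 1\<close> in another one therefore show that \<open>{0}\<close> has no countable local
  base and that the unit ball of \<open>\<delta>\<close> around \<open>{0}\<close> is not Wijsman open.\<close>

section \<open>Radial functions and the radial distance\<close>

text \<open>Inverse of \<open>radial_fun\<close> on star bodies: it names the set built in
  \<open>star_body_of_fun\<close>, so that bodies can be produced by prescribing their values on the
  sphere.\<close>

definition body_of_fun :: "('a::euclidean_space \<Rightarrow> ennreal) \<Rightarrow> 'a set" where
  "body_of_fun g = {r *\<^sub>R \<theta> | r \<theta>. \<theta> \<in> sphere 0 1 \<and> 0 \<le> r \<and> ennreal r \<le> g \<theta>}"

lemma body_of_fun_in_S_rc: "body_of_fun g \<in> S_rc"
  unfolding body_of_fun_def S_rc_def using star_body_of_fun(1) by blast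

lemma radial_fun_body_of_fun: "\<theta> \<in> sphere 0 1 \<Longrightarrow> radial_fun (body_of_fun g) \<theta> = g \<theta>"
  unfolding body_of_fun_def by (rule star_body_of_fun(2))

text \<open>Boundedness comes for free: a continuous real function on the compact sphere is bounded,
  and its bound also bounds the norms of the points of the body.\<close>

lemma body_of_fun_in_S_1_b:
  assumes cont: "continuous_on (sphere 0 1) f" and nonneg: "\<And>\<theta>. \<theta> \<in> sphere 0 1 \<Longrightarrow> 0 \<le> f \<theta>"
  shows "body_of_fun (\<lambda>\<theta>. ennreal (f \<theta>)) \<in> S_1_b"
proof -
  have "compact (f ` sphere 0 1)"
    by (intro compact_continuous_image cont compact_sphere)
  then obtain K where K: "\<And>\<theta>. \<theta> \<in> sphere 0 1 \<Longrightarrow> \<bar>f \<theta>\<bar> \<le> K"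
    using compact_imp_bounded[of "f ` sphere 0 1"] unfolding bounded_real by blast
  have "bounded (body_of_fun (\<lambda>\<theta>. ennreal (f \<theta>)))"
    unfolding bounded_iff
  proof (intro exI ballI)
    fix x assume "x \<in> body_of_fun (\<lambda>\<theta>. ennreal (f \<theta>))"
    then obtain r \<theta> where x: "x = r *\<^sub>R \<theta>" "\<theta> \<in> sphere 0 1" "0 \<le> r" "ennreal r \<le> ennreal (f \<theta>)"
      unfolding body_of_fun_def by blast
    then have "r \<le> f \<theta>"
      using nonneg by simp
    then show "norm x \<le> K"
      using x K[of \<theta>] by simp
  qed
  moreover have "continuous_on (sphere 0 1) (radial_fun (body_of_fun (\<lambda>\<theta>. ennreal (f \<theta>))))"
    using continuous_on_ennreal[OF cont]
    by (simp add: radial_fun_body_of_fun cong: continuous_on_cong_simp)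
  ultimately show ?thesis
    using body_of_fun_in_S_rc by (auto simp: S_1_b_def S_1_def)
qed

lemma S_1_subset_S_rc: "S_1 \<subseteq> S_rc"
  and S_1_b_subset_S_1: "S_1_b \<subseteq> S_1"
  and S_1_b_subset_S_rc_b: "S_1_b \<subseteq> S_rc_b"
  and S_rc_b_subset_S_rc: "S_rc_b \<subseteq> S_rc"
  by (auto simp: S_1_b_def S_1_def S_rc_b_def)

text \<open>Bridge between the two number systems: on bounded bodies the value \<open>top\<close>
  does not occur, so passing to \<open>real\<close> loses nothing.\<close>

lemma radial_fun_finite:
  assumes "A \<in> S_rc_b" "\<theta> \<in> sphere 0 1"
  shows "ennreal (enn2real (radial_fun A \<theta>)) = radial_fun A \<theta>"
  using radial_fun_bounded[OF assms(1)] assms(2)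
  by (metis ennreal_enn2real ennreal_less_top le_less_trans)

lemma radial_fun_cball:
  fixes \<theta> :: "'a::euclidean_space"
  assumes "0 < \<alpha>" "\<theta> \<in> sphere 0 1"
  shows "radial_fun (cball 0 \<alpha>) \<theta> = ennreal \<alpha>"
proof (rule antisym)
  show "radial_fun (cball 0 \<alpha>) \<theta> \<le> ennreal \<alpha>"
    unfolding radial_fun_def using assms by (intro SUP_least) (auto intro: ennreal_leI)
  show "ennreal \<alpha> \<le> radial_fun (cball 0 \<alpha>) \<theta>"
    using assms by (intro le_radial_funI) auto
qed

lemma mem_radial_sum_iff:
  assumes "\<theta> \<in> sphere 0 1" "0 \<le> r"
  shows "r *\<^sub>R \<theta> \<in> radial_sum A B \<longleftrightarrow> ennreal r \<le> radial_fun A \<theta> + radial_fun B \<theta>"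
proof -
  let ?g = "\<lambda>\<theta>. radial_fun A \<theta> + radial_fun B \<theta>"
  have "radial_sum A B = body_of_fun ?g"
    unfolding body_of_fun_def by (rule radial_sum_eq)
  moreover have "star_body (body_of_fun ?g)"
    using body_of_fun_in_S_rc by (simp add: S_rc_def)
  ultimately show ?thesis
    using star_body_mem_iff[OF _ assms] radial_fun_body_of_fun[OF assms(1)] by metis
qed

text \<open>The ball of radius \<alpha> has constant radial function \<alpha>, so membership in the
  radial sum becomes r \<le> \<rho>(\<theta>) + \<alpha> in the single direction \<theta>. Truncated
  subtraction in \<open>ennreal\<close> also covers \<rho>(\<theta>) = \<infinity>, where the
  distance is 0.\<close>

lemma radial_dist_polar:
  fixes \<theta> :: "'a::euclidean_space"
  assumes \<theta>: "\<theta> \<in> sphere 0 1" and r: "0 \<le> r"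
  shows "radial_dist (r *\<^sub>R \<theta>) A = enn2real (ennreal r - radial_fun A \<theta>)"
proof -
  have ball: "(*\<^sub>R) \<alpha> ` cball (0::'a) 1 = cball 0 \<alpha>" if "0 < \<alpha>" for \<alpha> :: real
    using cball_scale[of \<alpha> "0::'a" 1] that by simp
  have dist: "radial_dist (r *\<^sub>R \<theta>) A = Inf {\<alpha>. 0 < \<alpha> \<and> ennreal r \<le> radial_fun A \<theta> + ennreal \<alpha>}"
    unfolding radial_dist_def
    by (intro arg_cong[where f = Inf] Collect_cong conj_cong refl)
       (simp only: mem_radial_sum_iff[OF \<theta> r] ball radial_fun_cball[OF _ \<theta>])
  show ?thesis
  proof (cases "radial_fun A \<theta>")
    case top
    then have "{\<alpha>. 0 < \<alpha> \<and> ennreal r \<le> radial_fun A \<theta> + ennreal \<alpha>} = {0::real<..}"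
      by auto
    then show ?thesis
      using dist top by simp
  next
    case (real p)
    \<comment> \<open>If r \<le> p every positive \<alpha> qualifies and the infimum 0 is not
      attained; otherwise r - p is positive, so the condition 0 < \<alpha> is implied and the
      infimum is r - p.\<close>
    have "{\<alpha>. 0 < \<alpha> \<and> ennreal r \<le> radial_fun A \<theta> + ennreal \<alpha>} = (if r \<le> p then {0<..} else {r - p..})"
      using real r by (auto simp flip: ennreal_plus)
    moreover have "enn2real (ennreal r - radial_fun A \<theta>) = max 0 (r - p)"
    proof (cases "r \<le> p")
      case True
      then show ?thesis
        using real r by (simp add: ennreal_minus ennreal_neg)
    next
      case False
      then show ?thesis
        using real r by (simp add: ennreal_minus)
    qed
    ultimately show ?thesis
      using dist by auto
  qed
qed

lemma radial_dist_polar_bounded: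
  assumes "A \<in> S_rc_b" "\<theta> \<in> sphere 0 1" "0 \<le> r"
  shows "radial_dist (r *\<^sub>R \<theta>) A = max 0 (r - enn2real (radial_fun A \<theta>))"
proof -
  have "ennreal r - radial_fun A \<theta> = ennreal (r - enn2real (radial_fun A \<theta>))"
    using radial_fun_finite[OF assms(1,2)] by (metis enn2real_nonneg ennreal_minus)
  then show ?thesis
    unfolding radial_dist_polar[OF assms(2,3)] by (simp add: max_def ennreal_neg)
qed

section \<open>The radial Wijsman topology as a topology of pointwise convergence\<close>

lemma continuous_map_radial_dist:
  "continuous_map radial_Wijsman_topology euclideanreal (radial_dist x)"
proof (rule continuous_map[THEN iffD2], intro conjI allI impI)
  fix U :: "real set" assume "openin euclideanreal U"
  then have "{A \<in> S_rc. radial_dist x A \<in> U} \<in> {{A \<in> S_rc. radial_dist x A \<in> U} | x U. open U}"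
    by auto
  then show "openin radial_Wijsman_topology {A \<in> topspace radial_Wijsman_topology. radial_dist x A \<in> U}"
    unfolding topspace_radial_Wijsman_topology
    unfolding radial_Wijsman_topology_def by (rule topology_generated_by_Basis)
qed simp

text \<open>Universal property of an initial topology. Testing points of the form r\<theta>
  suffices, since every point has polar coordinates.\<close>

lemma continuous_map_into_radial_Wijsman:
  fixes f :: "'b \<Rightarrow> 'a::euclidean_space set"
  assumes mem: "\<And>y. y \<in> topspace T \<Longrightarrow> f y \<in> S_rc"
    and cont: "\<And>\<theta> r. \<theta> \<in> sphere 0 1 \<Longrightarrow> 0 \<le> r \<Longrightarrow>
      continuous_map T euclideanreal (\<lambda>y. radial_dist (r *\<^sub>R \<theta>) (f y))"
  shows "continuous_map T radial_Wijsman_topology f"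
  unfolding radial_Wijsman_topology_def
proof (rule continuous_on_generated_topo)
  fix V :: "'a set set" assume "V \<in> {{A \<in> S_rc. radial_dist x A \<in> U} | x U. open U}"
  then obtain x U where V: "V = {A \<in> S_rc. radial_dist x A \<in> U}" "open U"
    by blast
  obtain r \<theta> where x: "x = r *\<^sub>R \<theta>" "0 \<le> r" "\<theta> \<in> sphere 0 1"
    using polar_ex[of x] by blast
  have "f -` V \<inter> topspace T = {y \<in> topspace T. radial_dist x (f y) \<in> U}"
    using V mem by auto
  then show "openin T (f -` V \<inter> topspace T)"
    using openin_continuous_map_preimage[OF cont[OF x(3,2)]] V(2) x(1) by auto
next
  show "f ` topspace T \<subseteq> \<Union> {{A \<in> S_rc. radial_dist x A \<in> U} | x U. open U}"
    using mem by auto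
qed

text \<open>The distance at r\<theta> is max 0 (r - \<rho>(\<theta>)) and does not see values of
  \<rho>(\<theta>) above r, so no single test point recovers \<rho>(\<theta>). Continuity is
  therefore checked on the sets where \<rho>(\<theta>) lies above or below a threshold a, with r
  adapted to a.\<close>

lemma continuous_map_radial_fun:
  fixes \<theta> :: "'a::euclidean_space"
  assumes \<theta>: "\<theta> \<in> sphere 0 1" and S: "S \<subseteq> S_rc_b"
  shows "continuous_map (subtopology radial_Wijsman_topology S) euclideanreal
           (\<lambda>A. enn2real (radial_fun A \<theta>))"
proof -
  let ?T = "subtopology (radial_Wijsman_topology :: 'a set topology) S"
  have top: "topspace ?T = S"
    using S S_rc_b_subset_S_rc by (auto simp: topspace_radial_Wijsman_topology)
  have dist: "radial_dist (r *\<^sub>R \<theta>) A = max 0 (r - enn2real (radial_fun A \<theta>))"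
    if "A \<in> S" "0 \<le> r" for A r
    using radial_dist_polar_bounded[OF _ \<theta>] that S by blast
  have cont: "continuous_map ?T euclideanreal (radial_dist x)" for x :: 'a
    by (intro continuous_map_from_subtopology continuous_map_radial_dist)
  have opn: "openin ?T {A \<in> S. radial_dist x A \<in> U}" if "open U" for x :: 'a and U
    using openin_continuous_map_preimage[OF cont[of x], of U] that unfolding top by simp
  show ?thesis
    unfolding continuous_map_upper_lower_semicontinuous_lt top
  proof (intro conjI allI)
    fix a :: real
    show "openin ?T {A \<in> S. a < enn2real (radial_fun A \<theta>)}"
    proof (cases "0 \<le> a")
      case True
      \<comment> \<open>The radius a + 1 exceeds the threshold, so truncation does no harm: max 0 (a
        + 1 - \<rho>) < 1 exactly when a < \<rho>.\<close>
      have "{A \<in> S. a < enn2real (radial_fun A \<theta>)} = {A \<in> S. radial_dist ((a + 1) *\<^sub>R \<theta>) A \<in> {..<1}}"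
        using dist True by auto
      then show ?thesis
        using opn[OF open_lessThan] by simp
    next
      case False
      then have "a < enn2real (radial_fun A \<theta>)" for A
        using enn2real_nonneg[of "radial_fun A \<theta>"] by linarith
      then have "{A \<in> S. a < enn2real (radial_fun A \<theta>)} = topspace ?T"
        unfolding top by simp
      then show ?thesis
        by (metis openin_topspace)
    qed
    show "openin ?T {A \<in> S. enn2real (radial_fun A \<theta>) < a}"
    proof (cases "0 \<le> a")
      case True
      \<comment> \<open>Here the radius a itself works: max 0 (a - \<rho>) is positive exactly when
        \<rho> < a.\<close>
      have "{A \<in> S. enn2real (radial_fun A \<theta>) < a} = {A \<in> S. radial_dist (a *\<^sub>R \<theta>) A \<in> {0<..}}"
        using dist True by auto
      then show ?thesis
        using opn[OF open_greaterThan] by simp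
    next
      case False
      then have "\<not> enn2real (radial_fun A \<theta>) < a" for A
        using enn2real_nonneg[of "radial_fun A \<theta>"] by linarith
      then have "{A \<in> S. enn2real (radial_fun A \<theta>) < a} = {}"
        by simp
      then show ?thesis
        by (metis openin_empty)
    qed
  qed
qed

text \<open>The map sends a body to its real radial function, cut off outside the sphere to match
  the extensional carrier of the product. Each direction is continuous by a universal property:
  coordinatewise into the product, and through the distance functions into the Wijsman
  topology.\<close>

lemma S_1_b_homeomorphic_Cp_plus_sphere:
  "subtopology radial_Wijsman_topology (S_1_b :: 'a::euclidean_space set set)
     homeomorphic_space (Cp_plus_sphere :: ('a \<Rightarrow> real) topology)"
proof -
  let ?W = "subtopology radial_Wijsman_topology (S_1_b :: 'a set set)"
  let ?C = "Cp_plus_sphere :: ('a \<Rightarrow> real) topology"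
  let ?\<rho> = "\<lambda>A. restrict (\<lambda>\<theta>. enn2real (radial_fun A \<theta>)) (sphere (0::'a) 1)"
  let ?B = "\<lambda>f::'a \<Rightarrow> real. body_of_fun (\<lambda>\<theta>. ennreal (f \<theta>))"
  have topW: "topspace ?W = S_1_b"
    using S_1_subset_S_rc S_1_b_subset_S_1 by (auto simp: topspace_radial_Wijsman_topology)
  have topC: "topspace ?C = {f \<in> extensional (sphere 0 1).
      continuous_on (sphere 0 1) f \<and> (\<forall>\<theta>\<in>sphere 0 1. 0 \<le> f \<theta>)}"
    unfolding Cp_plus_sphere_def by (auto simp: PiE_def)
  have \<rho>_mem: "continuous_on (sphere 0 1) (?\<rho> A)" if "A \<in> S_1_b" for A
  proof -
    have A: "A \<in> S_rc_b" "continuous_on (sphere 0 1) (radial_fun A)"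
      using that S_1_b_subset_S_rc_b by (auto simp: S_1_b_def S_1_def)
    \<comment> \<open>\<open>enn2real\<close> is not continuous at \<open>top\<close>, so the limit
      is taken pointwise, using that every limit value is finite.\<close>
    have "continuous_on (sphere 0 1) (\<lambda>\<theta>. enn2real (radial_fun A \<theta>))"
      unfolding continuous_on_def
    proof
      fix \<theta> :: 'a assume \<theta>: "\<theta> \<in> sphere 0 1"
      show "((\<lambda>\<theta>. enn2real (radial_fun A \<theta>)) \<longlongrightarrow> enn2real (radial_fun A \<theta>)) (at \<theta> within sphere 0 1)"
      proof (rule tendsto_enn2real)
        show "(radial_fun A \<longlongrightarrow> ennreal (enn2real (radial_fun A \<theta>))) (at \<theta> within sphere 0 1)"
          using A(2) \<theta> radial_fun_finite[OF A(1) \<theta>] by (simp add: continuous_on_def)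
      qed simp
    qed
    then show ?thesis
      by (simp cong: continuous_on_cong_simp)
  qed
  have B_mem: "?B f \<in> S_1_b" if "f \<in> topspace ?C" for f
    using that by (intro body_of_fun_in_S_1_b) (auto simp: topC)
  have "continuous_map ?W ?C ?\<rho>"
    unfolding Cp_plus_sphere_def continuous_map_in_subtopology continuous_map_componentwise topW
  proof (intro conjI ballI)
    fix \<theta> :: 'a assume \<theta>: "\<theta> \<in> sphere 0 1"
    show "continuous_map ?W euclideanreal (\<lambda>A. ?\<rho> A \<theta>)"
      using continuous_map_radial_fun[OF \<theta> S_1_b_subset_S_rc_b] \<theta> by simp
  qed (use \<rho>_mem in auto)
  moreover have "continuous_map ?C ?W ?B"
  proof (rule continuous_map_into_subtopology)
    show "?B \<in> topspace ?C \<rightarrow> S_1_b"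
      using B_mem by blast
    show "continuous_map ?C radial_Wijsman_topology ?B"
    proof (rule continuous_map_into_radial_Wijsman)
      show "?B f \<in> S_rc" for f
        by (rule body_of_fun_in_S_rc)
      fix \<theta> :: 'a and r :: real assume \<theta>: "\<theta> \<in> sphere 0 1" and r: "0 \<le> r"
      \<comment> \<open>Evaluation at \<theta> is a coordinate projection, and the distance of
        r\<theta> to the body of f is a continuous function of it.\<close>
      have "continuous_map ?C euclideanreal (\<lambda>f. max 0 (r - f \<theta>))"
        unfolding Cp_plus_sphere_def
        by (intro continuous_intros \<theta>)
      then show "continuous_map ?C euclideanreal (\<lambda>f. radial_dist (r *\<^sub>R \<theta>) (?B f))"
      proof (rule continuous_map_eq)
        fix f assume f: "f \<in> topspace ?C"
        then have "0 \<le> f \<theta>" "?B f \<in> S_rc_b"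
          using \<theta> B_mem S_1_b_subset_S_rc_b by (auto simp: topC)
        then show "max 0 (r - f \<theta>) = radial_dist (r *\<^sub>R \<theta>) (?B f)"
          using radial_dist_polar_bounded[OF _ \<theta> r] radial_fun_body_of_fun[OF \<theta>] by simp
      qed
    qed
  qed
  moreover have "?B (?\<rho> A) = A" if "A \<in> S_1_b" for A
  proof (rule star_body_eqI)
    have A: "A \<in> S_rc_b"
      using that S_1_b_subset_S_rc_b by blast
    show "star_body (?B (?\<rho> A))" "star_body A"
      using body_of_fun_in_S_rc A S_rc_b_subset_S_rc by (auto simp: S_rc_def)
    fix \<theta> :: 'a assume "\<theta> \<in> sphere 0 1"
    then show "radial_fun (?B (?\<rho> A)) \<theta> = radial_fun A \<theta>"
      using radial_fun_finite[OF A] by (simp add: radial_fun_body_of_fun)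
  qed
  moreover have "?\<rho> (?B f) = f" if "f \<in> topspace ?C" for f
  proof (rule extensionalityI)
    show "f \<in> extensional (sphere 0 1)"
      using that topC by blast
    fix \<theta> :: 'a assume "\<theta> \<in> sphere 0 1"
    then show "?\<rho> (?B f) \<theta> = f \<theta>"
      using that by (auto simp: radial_fun_body_of_fun topC)
  qed simp
  ultimately have "homeomorphic_maps ?W ?C ?\<rho> ?B"
    unfolding homeomorphic_maps_def topW by blast
  then show ?thesis
    unfolding homeomorphic_space_def by blast
qed

section \<open>Neighbourhoods constrain only finitely many directions\<close>

text \<open>Induction over the generation of the topology: a subbasic set looks at one direction, an
  intersection unites two finite sets, and for a union one member containing A is enough. Asking for
  equality on F instead of closeness avoids any estimates.\<close>

lemma openin_radial_Wijsman_finite: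
  fixes \<U> :: "'a::euclidean_space set set"
  assumes "openin radial_Wijsman_topology \<U>" "A \<in> \<U>"
  shows "\<exists>F \<subseteq> sphere 0 1. finite F \<and>
           (\<forall>B\<in>S_rc. (\<forall>\<theta>\<in>F. radial_fun B \<theta> = radial_fun A \<theta>) \<longrightarrow> B \<in> \<U>)"
proof -
  have "generate_topology_on {{A \<in> S_rc. radial_dist x A \<in> U} | (x::'a) U. open U} \<U>"
    using assms(1) unfolding radial_Wijsman_topology_def by (rule openin_topology_generated_by)
  then show ?thesis
    using assms(2)
  proof (induction arbitrary: A)
    case Empty
    then show ?case by simp
  next
    case (Int \<V> \<W>)
    obtain F where F: "F \<subseteq> sphere 0 1" "finite F"
      "\<forall>B\<in>S_rc. (\<forall>\<theta>\<in>F. radial_fun B \<theta> = radial_fun A \<theta>) \<longrightarrow> B \<in> \<V>"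
      using Int.IH(1)[of A] Int.prems by blast
    obtain G where G: "G \<subseteq> sphere 0 1" "finite G"
      "\<forall>B\<in>S_rc. (\<forall>\<theta>\<in>G. radial_fun B \<theta> = radial_fun A \<theta>) \<longrightarrow> B \<in> \<W>"
      using Int.IH(2)[of A] Int.prems by blast
    show ?case
      by (intro exI[of _ "F \<union> G"]) (use F G in auto)
  next
    case (UN K)
    then obtain \<V> where \<V>: "\<V> \<in> K" "A \<in> \<V>" by blast
    show ?case
      using UN.IH[OF \<V>] \<V>(1) by (meson UnionI)
  next
    case (Basis \<V>)
    then obtain x :: 'a and U where V: "\<V> = {A \<in> S_rc. radial_dist x A \<in> U}"
      by blast
    obtain r \<theta> where x: "x = r *\<^sub>R \<theta>" "0 \<le> r" "\<theta> \<in> sphere 0 1"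
      using polar_ex[of x] by blast
    \<comment> \<open>By \<open>radial_dist_polar\<close>, the distance at r\<theta> depends on the
      body only through its radial function at \<theta>.\<close>
    show ?case
      by (intro exI[of _ "{\<theta>}"]) (use Basis V x in \<open>auto simp: radial_dist_polar\<close>)
  qed
qed

section \<open>Test bodies near the origin, and failure of metrizability\<close>

lemma origin_in_S_1_b: "({0} :: 'a::euclidean_space set) \<in> S_1_b"
  and radial_fun_origin: "\<theta> \<in> sphere 0 1 \<Longrightarrow> radial_fun ({0} :: 'a set) \<theta> = 0"
proof -
  have eq: "body_of_fun (\<lambda>\<theta>::'a. ennreal 0) = {0}"
  proof (intro equalityI subsetI)
    fix x :: 'a assume "x \<in> {0}"
    then show "x \<in> body_of_fun (\<lambda>\<theta>. ennreal 0)"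
      using polar_ex[of x] unfolding body_of_fun_def by force
  qed (auto simp: body_of_fun_def)
  show "({0} :: 'a set) \<in> S_1_b"
    using body_of_fun_in_S_1_b[of "\<lambda>_::'a. 0"] by (simp add: eq del: ennreal_0)
  show "\<theta> \<in> sphere 0 1 \<Longrightarrow> radial_fun ({0} :: 'a set) \<theta> = 0"
    using radial_fun_body_of_fun[of \<theta> "\<lambda>_. ennreal 0"] by (simp add: eq del: ennreal_0)
qed

text \<open>The radial function is a normalized product of distances to the points of F: one factor
  vanishes at each point of F, and all factors equal 1 at \<theta>. The denominators are nonzero
  because \<theta> lies outside F.\<close>

lemma ex_body_separating:
  fixes F :: "'a::euclidean_space set"
  assumes "finite F" "F \<subseteq> sphere 0 1" "\<theta> \<in> sphere 0 1" "\<theta> \<notin> F"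
  shows "\<exists>B\<in>S_1_b. (\<forall>\<phi>\<in>F. radial_fun B \<phi> = 0) \<and> radial_fun B \<theta> = 1"
proof
  define f where "f \<phi> = (\<Prod>a\<in>F. norm (\<phi> - a) / norm (\<theta> - a))" for \<phi>
  show "body_of_fun (\<lambda>\<phi>. ennreal (f \<phi>)) \<in> S_1_b"
  proof (rule body_of_fun_in_S_1_b)
    show "continuous_on (sphere 0 1) f"
      unfolding f_def using assms(4) by (intro continuous_intros) auto
    show "0 \<le> f \<phi>" for \<phi>
      unfolding f_def by (intro prod_nonneg) auto
  qed
  have "f \<phi> = 0" if "\<phi> \<in> F" for \<phi>
    unfolding f_def using that assms(1) by (intro prod_zero) auto
  moreover have "f \<theta> = 1"
    unfolding f_def using assms(4) by (intro prod.neutral) auto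
  ultimately show "(\<forall>\<phi>\<in>F. radial_fun (body_of_fun (\<lambda>\<phi>. ennreal (f \<phi>))) \<phi> = 0) \<and>
      radial_fun (body_of_fun (\<lambda>\<phi>. ennreal (f \<phi>))) \<theta> = 1"
    using assms(2,3) by (auto simp: radial_fun_body_of_fun subset_iff)
qed

text \<open>For d \<ge> 2 the sphere is connected and contains the two distinct points \<theta> and
  -\<theta>; a connected set with two points in a metric space is uncountable.\<close>

lemma uncountable_unit_sphere:
  assumes "2 \<le> DIM('a::euclidean_space)"
  shows "uncountable (sphere (0::'a) 1)"
proof -
  obtain \<theta> :: 'a where \<theta>: "\<theta> \<in> sphere 0 1"
    using polar_ex by blast
  then have "\<theta> \<noteq> 0"
    by auto
  then have "\<theta> \<noteq> - \<theta>"
    by (simp add: eq_neg_iff_add_eq_0 flip: scaleR_2)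
  then show ?thesis
    using connected_uncountable[OF connected_sphere[OF assms], of \<theta> 0 1 "- \<theta>"] \<theta> by simp
qed

text \<open>A countable local base at \<open>{0}\<close> would involve only countably many
  directions in total, which leaves some \<theta> unconstrained by every base member.\<close>

lemma not_metrizable_S_1_b:
  assumes "2 \<le> DIM('a::euclidean_space)"
  shows "\<not> metrizable_space (subtopology radial_Wijsman_topology (S_1_b :: 'a set set))"
proof
  let ?W = "subtopology radial_Wijsman_topology (S_1_b :: 'a set set)"
  have topW: "topspace ?W = S_1_b"
    using S_1_subset_S_rc S_1_b_subset_S_1 by (auto simp: topspace_radial_Wijsman_topology)
  assume "metrizable_space ?W"
  then have "first_countable ?W"
    by (rule metrizable_imp_first_countable)
  then obtain \<B> where "countable \<B>" and opn: "\<And>\<V>. \<V> \<in> \<B> \<Longrightarrow> openin ?W \<V>"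
    and base: "\<And>\<U>. openin ?W \<U> \<Longrightarrow> {0} \<in> \<U> \<Longrightarrow> \<exists>\<V>\<in>\<B>. {0} \<in> \<V> \<and> \<V> \<subseteq> \<U>"
    unfolding first_countable_def topW using origin_in_S_1_b by metis
  define \<N> where "\<N> = {\<V> \<in> \<B>. {0} \<in> \<V>}"
  have "\<exists>F \<subseteq> sphere 0 1. finite F \<and> (\<forall>B\<in>S_1_b. (\<forall>\<theta>\<in>F. radial_fun B \<theta> = 0) \<longrightarrow> B \<in> \<V>)"
    if "\<V> \<in> \<N>" for \<V>
  proof -
    have \<V>: "openin ?W \<V>" "{0} \<in> \<V>"
      using that opn by (auto simp: \<N>_def)
    obtain \<U> where \<U>: "openin radial_Wijsman_topology \<U>" "\<V> = \<U> \<inter> S_1_b"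
      using \<V>(1) by (auto simp: openin_subtopology)
    obtain F where F: "F \<subseteq> sphere 0 1" "finite F"
      "\<forall>B\<in>S_rc. (\<forall>\<theta>\<in>F. radial_fun B \<theta> = radial_fun {0} \<theta>) \<longrightarrow> B \<in> \<U>"
      using openin_radial_Wijsman_finite[OF \<U>(1), of "{0}"] \<V>(2) \<U>(2) by blast
    then show ?thesis
      using \<U>(2) S_1_b_subset_S_1 S_1_subset_S_rc
      by (intro exI[of _ F]) (auto simp: subset_iff radial_fun_origin)
  qed
  then obtain F where F: "\<And>\<V>. \<V> \<in> \<N> \<Longrightarrow> F \<V> \<subseteq> sphere 0 1" "\<And>\<V>. \<V> \<in> \<N> \<Longrightarrow> finite (F \<V>)"
    "\<And>\<V> B. \<V> \<in> \<N> \<Longrightarrow> B \<in> S_1_b \<Longrightarrow> \<forall>\<theta>\<in>F \<V>. radial_fun B \<theta> = 0 \<Longrightarrow> B \<in> \<V>"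
    by metis
  have ctbl: "countable (\<Union>\<V>\<in>\<N>. F \<V>)"
    using \<open>countable \<B>\<close> F(2) by (intro countable_UN) (auto simp: \<N>_def countable_finite)
  obtain \<theta> where \<theta>: "\<theta> \<in> sphere 0 1" "\<theta> \<notin> (\<Union>\<V>\<in>\<N>. F \<V>)"
    using uncountable_unit_sphere[OF assms] countable_subset[OF _ ctbl] by blast
  \<comment> \<open>The condition \<rho>(\<theta>) < 1 defines a neighbourhood of \<open>{0}\<close>
    that no base member fits into: each contains a body with \<rho>(\<theta>) = 1.\<close>
  have "openin ?W {A \<in> topspace ?W. enn2real (radial_fun A \<theta>) \<in> {..<1}}"
    by (rule openin_continuous_map_preimage[OF continuous_map_radial_fun[OF \<theta>(1) S_1_b_subset_S_rc_b]])
       simp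
  moreover have "{0} \<in> {A \<in> topspace ?W. enn2real (radial_fun A \<theta>) \<in> {..<1}}"
    unfolding topW using origin_in_S_1_b radial_fun_origin[OF \<theta>(1)] by simp
  ultimately obtain \<V> where \<V>: "\<V> \<in> \<N>" "\<V> \<subseteq> {A \<in> topspace ?W. enn2real (radial_fun A \<theta>) \<in> {..<1}}"
    using base unfolding \<N>_def by blast
  obtain B where B: "B \<in> S_1_b" "\<forall>\<phi>\<in>F \<V>. radial_fun B \<phi> = 0" "radial_fun B \<theta> = 1"
    using ex_body_separating[OF F(2,1)[OF \<V>(1)] \<theta>(1)] \<theta>(2) \<V>(1) by blast
  then show False
    using F(3)[OF \<V>(1)] \<V>(2) by fastforce
qed

text \<open>Metrizability passes to subspaces, so its failure on \<open>S_1_b\<close> carries over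
  to larger families. Since \<open>S\<close> may exceed \<open>S_rc\<close>, the choice
  \<open>UNIV\<close> yields the whole topology.\<close>

lemma not_metrizable_superspace:
  assumes "2 \<le> DIM('a::euclidean_space)" "(S_1_b :: 'a set set) \<subseteq> S"
  shows "\<not> metrizable_space (subtopology radial_Wijsman_topology S)"
  using not_metrizable_S_1_b[OF assms(1)] metrizable_space_subtopology[of _ S_1_b] assms(2)
  by (metis inf.absorb2 subtopology_subtopology)

section \<open>Comparison with the radial metric\<close>

text \<open>A real supremum dominates its members only over a set that is bounded above; bounds K
  and L for the two bodies provide this.\<close>

lemma abs_radial_fun_diff_le:
  assumes "A \<in> S_rc_b" "B \<in> S_rc_b" "\<theta> \<in> sphere 0 1"
  shows "\<bar>enn2real (radial_fun A \<theta>) - enn2real (radial_fun B \<theta>)\<bar> \<le> radial_metric A B"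
proof -
  obtain K where K: "0 \<le> K" "\<And>\<theta>. \<theta> \<in> sphere 0 1 \<Longrightarrow> radial_fun A \<theta> \<le> ennreal K"
    using radial_fun_bounded[OF assms(1)] by blast
  obtain L where L: "0 \<le> L" "\<And>\<theta>. \<theta> \<in> sphere 0 1 \<Longrightarrow> radial_fun B \<theta> \<le> ennreal L"
    using radial_fun_bounded[OF assms(2)] by blast
  have "\<bar>enn2real (radial_fun A \<theta>) - enn2real (radial_fun B \<theta>)\<bar> \<le> K + L" if "\<theta> \<in> sphere 0 1" for \<theta>
    using enn2real_leI[OF K(1) K(2)[OF that]] enn2real_leI[OF L(1) L(2)[OF that]]
      enn2real_nonneg[of "radial_fun A \<theta>"] enn2real_nonneg[of "radial_fun B \<theta>"]
    by linarith
  then have "bdd_above ((\<lambda>\<theta>. \<bar>enn2real (radial_fun A \<theta>) - enn2real (radial_fun B \<theta>)\<bar>) ` sphere 0 1)"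
    by (rule bdd_aboveI2)
  then show ?thesis
    using assms cSUP_upper[of \<theta> "sphere 0 1"] by (simp add: radial_metric_def)
qed

lemma topspace_radial_metric_topology: "topspace radial_metric_topology = S_rc_b"
  unfolding radial_metric_topology_def
  using Metric_space.topspace_mtopology[OF Metric_space_radial_metric] .

text \<open>Since t \<mapsto> max 0 (r - t) is 1-Lipschitz, each distance function is 1-Lipschitz
  for \<delta>.\<close>

lemma continuous_map_radial_metric_Wijsman:
  "continuous_map radial_metric_topology radial_Wijsman_topology (\<lambda>A. A)"
proof (rule continuous_map_into_radial_Wijsman)
  show "A \<in> S_rc" if "A \<in> topspace radial_metric_topology" for A :: "'a set"
    using that S_rc_b_subset_S_rc by (auto simp: topspace_radial_metric_topology)
next
  fix \<theta> :: 'a and r :: real assume \<theta>: "\<theta> \<in> sphere 0 1" and r: "0 \<le> r"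
  have close: "dist (radial_dist (r *\<^sub>R \<theta>) A) (radial_dist (r *\<^sub>R \<theta>) B) \<le> radial_metric A B"
    if "A \<in> S_rc_b" "B \<in> S_rc_b" for A B
    using abs_radial_fun_diff_le[OF that \<theta>] radial_dist_polar_bounded[OF that(1) \<theta> r]
      radial_dist_polar_bounded[OF that(2) \<theta> r]
    by (simp add: dist_real_def)
  show "continuous_map radial_metric_topology euclideanreal (radial_dist (r *\<^sub>R \<theta>))"
    unfolding radial_metric_topology_def mtopology_is_euclidean[symmetric]
      Metric_space.metric_continuous_map[OF Metric_space_radial_metric Met_TC.Metric_space_axioms]
    using close by (auto intro: le_less_trans)
qed

text \<open>Stated for every family between \<open>S_1_b\<close> and \<open>S_rc_b\<close>, so that
  both extremes follow from one argument; the separating bodies already lie in the smallest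
  family.\<close>

lemma radial_Wijsman_strictly_coarser:
  fixes S :: "'a::euclidean_space set set"
  assumes dim: "2 \<le> DIM('a)" and S: "S_1_b \<subseteq> S" "S \<subseteq> S_rc_b"
  shows "{\<U>. openin (subtopology radial_Wijsman_topology S) \<U>}
       \<subset> {\<U>. openin (subtopology radial_metric_topology S) \<U>}"
proof (rule psubsetI)
  show "{\<U>. openin (subtopology radial_Wijsman_topology S) \<U>}
      \<subseteq> {\<U>. openin (subtopology radial_metric_topology S) \<U>}"
  proof (intro subsetI CollectI, elim CollectE)
    fix \<U> assume "openin (subtopology radial_Wijsman_topology S) \<U>"
    then obtain \<V> where \<V>: "openin radial_Wijsman_topology \<V>" "\<U> = \<V> \<inter> S"
      by (auto simp: openin_subtopology)
    have "openin radial_metric_topology {A \<in> S_rc_b. A \<in> \<V>}"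
      using openin_continuous_map_preimage[OF continuous_map_radial_metric_Wijsman \<V>(1)]
      by (simp add: topspace_radial_metric_topology)
    moreover have "\<U> = {A \<in> S_rc_b. A \<in> \<V>} \<inter> S"
      using \<V>(2) S(2) by blast
    ultimately show "openin (subtopology radial_metric_topology S) \<U>"
      unfolding openin_subtopology by blast
  qed
  interpret M: Metric_space "S_rc_b :: 'a set set" radial_metric
    by (rule Metric_space_radial_metric)
  \<comment> \<open>The open unit ball shows strictness: a Wijsman neighbourhood of
    \<open>{0}\<close> contains a body with \<rho>(\<theta>) = 1 for some \<theta>, whose
    \<delta>-distance from \<open>{0}\<close> is at least 1.\<close>
  let ?N = "M.mball {0} 1 \<inter> S"
  have "openin (subtopology radial_metric_topology S) ?N"
    unfolding openin_subtopology radial_metric_topology_def using M.openin_mball by blast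
  moreover have "\<not> openin (subtopology radial_Wijsman_topology S) ?N"
  proof
    assume "openin (subtopology radial_Wijsman_topology S) ?N"
    then obtain \<V> where \<V>: "openin radial_Wijsman_topology \<V>" "?N = \<V> \<inter> S"
      by (auto simp: openin_subtopology)
    have origin: "({0} :: 'a set) \<in> S_rc_b" "{0} \<in> S"
      using origin_in_S_1_b S by auto
    then have "{0} \<in> \<V>"
      using \<V>(2) M.centre_in_mball_iff[of "{0}" 1] by auto
    then obtain F where F: "F \<subseteq> sphere 0 1" "finite F"
      "\<forall>B\<in>S_rc. (\<forall>\<theta>\<in>F. radial_fun B \<theta> = radial_fun {0} \<theta>) \<longrightarrow> B \<in> \<V>"
      using openin_radial_Wijsman_finite[OF \<V>(1)] by blast
    obtain \<theta> where \<theta>: "\<theta> \<in> sphere 0 1" "\<theta> \<notin> F"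
      using uncountable_unit_sphere[OF dim] countable_subset[OF _ countable_finite[OF F(2)]] by blast
    obtain B where B: "B \<in> S_1_b" "\<forall>\<phi>\<in>F. radial_fun B \<phi> = 0" "radial_fun B \<theta> = 1"
      using ex_body_separating[OF F(2,1) \<theta>] by blast
    have "B \<in> S_rc"
      using B(1) S_1_b_subset_S_1 S_1_subset_S_rc by blast
    then have "B \<in> \<V>"
      using F(1,3) B(2) by (simp add: radial_fun_origin subset_iff)
    then have "B \<in> M.mball {0} 1"
      using \<V>(2) B(1) S(1) by blast
    then have "radial_metric {0} B < 1" "B \<in> S_rc_b"
      by auto
    then show False
      using abs_radial_fun_diff_le[OF origin(1) _ \<theta>(1), of B] B(3) radial_fun_origin[OF \<theta>(1)] by simp
  qed
  ultimately show "{\<U>. openin (subtopology radial_Wijsman_topology S) \<U>}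
      \<noteq> {\<U>. openin (subtopology radial_metric_topology S) \<U>}"
    by blast
qed

theorem corollary3p3:
  assumes "CARD('n::finite) \<ge> 2"
  shows
    "(subtopology radial_Wijsman_topology (S_1_b :: (real^'n) set set)
       homeomorphic_space (Cp_plus_sphere :: (real^'n \<Rightarrow> real) topology))
    \<and> \<not> metrizable_space (subtopology radial_Wijsman_topology (S_1_b :: (real^'n) set set))
    \<and> \<not> metrizable_space (subtopology radial_Wijsman_topology (S_1 :: (real^'n) set set))
    \<and> \<not> metrizable_space (radial_Wijsman_topology :: (real^'n) set topology)
    \<and> ({\<U>. openin (subtopology radial_Wijsman_topology (S_1_b :: (real^'n) set set)) \<U>}
        \<subset> {\<U>. openin (subtopology radial_metric_topology (S_1_b :: (real^'n) set set)) \<U>})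
    \<and> ({\<U>. openin (subtopology radial_Wijsman_topology (S_rc_b :: (real^'n) set set)) \<U>}
        \<subset> {\<U>. openin (radial_metric_topology :: (real^'n) set topology) \<U>})"
proof -
  have dim: "2 \<le> DIM(real^'n)"
    using assms by simp
  have radial: "subtopology radial_metric_topology S_rc_b = (radial_metric_topology :: (real^'n) set topology)"
    using subtopology_topspace[of radial_metric_topology] by (simp add: topspace_radial_metric_topology)
  show ?thesis
    using S_1_b_homeomorphic_Cp_plus_sphere
      not_metrizable_superspace[OF dim order_refl]
      not_metrizable_superspace[OF dim S_1_b_subset_S_1]
      not_metrizable_superspace[OF dim subset_UNIV, unfolded subtopology_UNIV]
      radial_Wijsman_strictly_coarser[OF dim order_refl S_1_b_subset_S_rc_b]
      radial_Wijsman_strictly_coarser[OF dim S_1_b_subset_S_rc_b order_refl, unfolded radial]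
    by (intro conjI)
qed

end
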